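(* For all integers $m\ge 1$, $k\ge 1$, $n\ge 1$, let $r(m,k,n)$ be the largest real number $r$ such that for every multicake $C$ with $m$ islands and every $n$ value-measures $V_1,\dots,V_n$ on $C$ there exists a $k$-feasible allocation $(Z_1,\dots,Z_n)$ of $C$ with $V_i(Z_i)\ge r\cdot V_i(C)$ for all $i\in\{1,\dots,n\}$. Then $$r(m,k,n)=\min\left(\frac1n,\ \frac{k}{m+n-1}\right).$$
   Context: A multicake $C$ with $m$ islands is the union of $m$ pairwise-disjoint intervals of unit length on the real line; these $m$ intervals are the islands. A value-measure on $C$ is a function of the form $V(Z)=\int_{Z} v(x)\,dx$ for (measurable) $Z\subseteq C$, where $v:C\to\mathbb{R}_{\ge 0}$ is integrable. An allocation is a vector $(Z_1,\dots,Z_n)$ of pairwise-disjoint subsets of $C$; their union need not be all of $C$ (free disposal). An allocation is $k$-feasible if each $Z_i$ is the union of at most $k$ intervals, each contained in a single island (so $Z_i$ overlaps at most $k$ islands). *)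

theory Defs
  imports "HOL-Analysis.Analysis"
begin

text \<open>
  A multicake is represented by its set of islands rather than by their union, since the union
  does not determine the islands when two of them abut, as [0,1) and [1,2] do.
  The islands may be open, closed or half-open.
\<close>

definition multicake :: "nat \<Rightarrow> real set set \<Rightarrow> bool" where
  "multicake m Islands \<longleftrightarrow>
     finite Islands \<and> card Islands = m \<and> disjoint Islands \<and>
     (\<forall>I\<in>Islands. is_interval I \<and> measure lborel I = 1)"

text \<open>Nothing is required of \<open>V\<close> outside the measurable subsets of \<open>C\<close>.\<close>

definition value_measure :: "real set \<Rightarrow> (real set \<Rightarrow> real) \<Rightarrow> bool" where
  "value_measure C V \<longleftrightarrow>
     (\<exists>v :: real \<Rightarrow> real. (\<forall>x\<in>C. 0 \<le> v x) \<and> set_integrable lebesgue C v \<and>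
        (\<forall>Z. Z \<in> sets lebesgue \<longrightarrow> Z \<subseteq> C \<longrightarrow> V Z = (LINT x:Z|lebesgue. v x)))"

definition allocation :: "real set \<Rightarrow> nat \<Rightarrow> (nat \<Rightarrow> real set) \<Rightarrow> bool" where
  "allocation C n Z \<longleftrightarrow> (\<forall>i\<in>{1..n}. Z i \<subseteq> C) \<and> disjoint_family_on Z {1..n}"

definition feasible :: "real set set \<Rightarrow> nat \<Rightarrow> nat \<Rightarrow> (nat \<Rightarrow> real set) \<Rightarrow> bool" where
  "feasible Islands k n Z \<longleftrightarrow>
     (\<forall>i\<in>{1..n}. \<exists>\<J>. finite \<J> \<and> card \<J> \<le> k \<and> Z i = \<Union>\<J> \<and>
        (\<forall>J\<in>\<J>. is_interval J \<and> (\<exists>I\<in>Islands. J \<subseteq> I)))"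

definition guaranteed :: "nat \<Rightarrow> nat \<Rightarrow> nat \<Rightarrow> real \<Rightarrow> bool" where
  "guaranteed m k n r \<longleftrightarrow>
     (\<forall>Islands V. multicake m Islands \<longrightarrow> (\<forall>i\<in>{1..n}. value_measure (\<Union>Islands) (V i)) \<longrightarrow>
        (\<exists>Z. allocation (\<Union>Islands) n Z \<and> feasible Islands k n Z \<and>
             (\<forall>i\<in>{1..n}. V i (Z i) \<ge> r * V i (\<Union>Islands))))"

text \<open>
  \<open>GREATEST\<close> is unspecified if there is no largest element, so a statement about
  \<open>best_ratio\<close> should also assert that the largest element exists.
\<close>

definition best_ratio :: "nat \<Rightarrow> nat \<Rightarrow> nat \<Rightarrow> real" where
  "best_ratio m k n = (GREATEST r. guaranteed m k n r)"

end

theory Submission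
  imports Defs "HOL-Probability.Distribution_Functions"
begin

text \<open>
  That no larger ratio is possible is shown by one example with identical agents, in which all islands
  are worth 1 except for one that is worth n (lemma \<open>guaranteed_le_min\<close>).

  For existence, write N for the current number of agents and J for the current number of islands, and
  fix amounts c i such that agent i values the whole cake at c i * (J + N - 1) or more. Say that a
  part of the cake satisfies agent i if i values it at k * c i or more. If J > N * (k - 1), then
  everyone can be satisfied with k intervals (lemma \<open>fair_portions\<close>). The proof is by
  induction on N. It suffices to let some agents leave satisfied such that, for each of them, the
  number of islands drops by k - 1 and no remaining agent i loses more than k * c i. There are two
  ways to do this.

  Suppose that any k - 1 whole islands satisfy some agent. Then N disjoint groups of k - 1 islands
  exist, and each satisfies at least one of the N agents. Hence there is a nonempty envy-free matching
  between groups and agents: no unmatched agent would be satisfied by a matched group. The matched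
  agents leave with their groups.

  Otherwise some k - 1 islands satisfy nobody, whereas an agent's k best islands satisfy that agent,
  to whom an island is worth c i or more on average. By exchanging islands one at a time one finds k -
  1 islands that satisfy nobody and one further island whose addition satisfies somebody. A knife
  moving along this further island then finds the first agent to be satisfied, who takes the k - 1
  islands and the part to the left of the knife. The part to the right of it counts as an island from
  then on.

  The condition J > N * (k - 1) is reached by adding empty islands; where this is necessary, the
  guarantee becomes 1 / n.
\<close>

section \<open>Matchings and subset sums\<close>

text \<open>
  Hall's theorem. If some proper nonempty subfamily \<open>K\<close> has no more candidates than members, then
  \<open>K\<close> uses up all of its candidates, and the other members still satisfy Hall's condition without them.
  If there is no such \<open>K\<close>, then any representative can be chosen for any one member, since each
  remaining subfamily can spare a candidate.
\<close>
lemma hall_distinct_representatives: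
  assumes "finite I" and "\<And>i. i \<in> I \<Longrightarrow> finite (A i)"
    and "\<And>K. K \<subseteq> I \<Longrightarrow> card K \<le> card (\<Union>i\<in>K. A i)"
  shows "\<exists>\<sigma>. inj_on \<sigma> I \<and> (\<forall>i\<in>I. \<sigma> i \<in> A i)"
  using assms
proof (induction "card I" arbitrary: I A rule: less_induct)
  case less
  note fin = less.prems(1) and finA = less.prems(2) and hall = less.prems(3)
  show ?case
  proof (cases "\<exists>K. K \<subseteq> I \<and> K \<noteq> {} \<and> K \<noteq> I \<and> card (\<Union>i\<in>K. A i) \<le> card K")
    case True
    then obtain K where K: "K \<subseteq> I" "K \<noteq> {}" "K \<noteq> I" "card (\<Union>i\<in>K. A i) \<le> card K" by blast
    let ?U = "\<Union>i\<in>K. A i"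
    let ?B = "\<lambda>i. A i - ?U"
    have finK: "finite K" using K(1) fin finite_subset by blast
    have finU: "finite ?U" using finK finA K(1) by auto
    have "card K < card I" using K fin by (simp add: psubset_card_mono psubsetI)
    then have "\<exists>\<sigma>. inj_on \<sigma> K \<and> (\<forall>i\<in>K. \<sigma> i \<in> A i)"
      using K(1) finK finA hall by (intro less.hyps) auto
    then obtain \<sigma> where \<sigma>: "inj_on \<sigma> K" "\<forall>i\<in>K. \<sigma> i \<in> A i" by blast
    have "card (I - K) < card I"
      using K fin by (intro psubset_card_mono) auto
    moreover have "card L \<le> card (\<Union>i\<in>L. ?B i)" if L: "L \<subseteq> I - K" for L
    proof -
      have finL: "finite L" using L fin finite_subset by blast
      have finUL: "finite (\<Union>i\<in>L. ?B i)" using finL finA L by auto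
      have eq: "(\<Union>i\<in>K \<union> L. A i) = ?U \<union> (\<Union>i\<in>L. ?B i)" by auto
      have "card K + card L = card (K \<union> L)"
        using L finK finL by (subst card_Un_disjoint) auto
      also have "\<dots> \<le> card (\<Union>i\<in>K \<union> L. A i)" using K(1) L by (intro hall) auto
      also have "\<dots> = card ?U + card (\<Union>i\<in>L. ?B i)"
        unfolding eq using finU finUL by (intro card_Un_disjoint) auto
      finally show ?thesis using K(4) by linarith
    qed
    ultimately have "\<exists>\<tau>. inj_on \<tau> (I - K) \<and> (\<forall>i\<in>I - K. \<tau> i \<in> ?B i)"
      using fin finA by (intro less.hyps) auto
    then obtain \<tau> where \<tau>: "inj_on \<tau> (I - K)" "\<forall>i\<in>I - K. \<tau> i \<in> ?B i" by blast
    let ?\<rho> = "\<lambda>i. if i \<in> K then \<sigma> i else \<tau> i"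
    have "\<sigma> ` K \<subseteq> ?U" "\<tau> ` (I - K) \<inter> ?U = {}" using \<sigma>(2) \<tau>(2) by blast+
    then have "inj_on ?\<rho> (K \<union> (I - K))"
      by (intro inj_on_disjoint_Un \<sigma>(1) \<tau>(1)) blast
    then have "inj_on ?\<rho> I" using K(1) by (simp add: Un_absorb1)
    moreover have "\<forall>i\<in>I. ?\<rho> i \<in> A i" using \<sigma> \<tau> by auto
    ultimately show ?thesis by blast
  next
    case False
    show ?thesis
    proof (cases "I = {}")
      case False
      then obtain i where i: "i \<in> I" by blast
      have "card {i} \<le> card (\<Union>l\<in>{i}. A l)" using i by (intro hall) auto
      then have "A i \<noteq> {}" by auto
      then obtain a where a: "a \<in> A i" by blast
      let ?B = "\<lambda>l. A l - {a}"
      have "card (I - {i}) < card I" using i fin by (metis card_Diff1_less)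
      moreover have "card L \<le> card (\<Union>l\<in>L. ?B l)" if L: "L \<subseteq> I - {i}" for L
      proof (cases "L = {}")
        case False
        then have "card L < card (\<Union>l\<in>L. A l)"
          using L i \<open>\<not> (\<exists>K. _ K)\<close> by (metis Diff_empty not_less subset_Diff_insert subset_trans)
        moreover have "(\<Union>l\<in>L. ?B l) = (\<Union>l\<in>L. A l) - {a}" by auto
        ultimately show ?thesis by (auto simp: card_Diff_singleton_if)
      qed auto
      ultimately have "\<exists>\<tau>. inj_on \<tau> (I - {i}) \<and> (\<forall>l\<in>I - {i}. \<tau> l \<in> ?B l)"
        using fin finA by (intro less.hyps) auto
      then obtain \<tau> where \<tau>: "inj_on \<tau> (I - {i})" "\<forall>l\<in>I - {i}. \<tau> l \<in> ?B l" by blast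
      have "inj_on (\<tau>(i := a)) (insert i (I - {i}))"
        unfolding inj_on_insert using \<tau> by (auto simp: inj_on_def)
      then have "inj_on (\<tau>(i := a)) I" using i by (simp add: insert_absorb)
      moreover have "\<forall>l\<in>I. (\<tau>(i := a)) l \<in> A l" using \<tau> a by auto
      ultimately show ?thesis by blast
    qed auto
  qed
qed

text \<open>
  An envy-free matching: an element of \<open>X\<close> that is left unmatched has none of the matched indices in its
  neighbourhood, because the representatives of \<open>T\<close> exhaust the neighbours of \<open>T\<close>. A smallest nonempty
  \<open>T\<close> that does not have more neighbours than members works: each of its nonempty proper subsets has
  strictly more neighbours than members, so \<open>T\<close> satisfies Hall's condition and has exactly as many
  neighbours as members.
\<close>
lemma envy_free_matching:
  assumes fin: "finite I" and "I \<noteq> {}" and "finite X" and "card X \<le> card I"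
    and A: "\<And>i. i \<in> I \<Longrightarrow> A i \<subseteq> X \<and> A i \<noteq> {}"
  shows "\<exists>T \<sigma>. T \<subseteq> I \<and> T \<noteq> {} \<and> inj_on \<sigma> T \<and> (\<forall>i\<in>T. \<sigma> i \<in> A i) \<and> \<sigma> ` T = (\<Union>i\<in>T. A i)"
proof -
  let ?P = "\<lambda>T. T \<subseteq> I \<and> T \<noteq> {} \<and> card (\<Union>i\<in>T. A i) \<le> card T"
  have "card (\<Union>i\<in>I. A i) \<le> card X" using A \<open>finite X\<close> by (intro card_mono) auto
  then have "?P I" using assms by auto
  then obtain T where T: "?P T" and least: "\<And>T'. ?P T' \<Longrightarrow> card T \<le> card T'"
    using ex_has_least_nat[of ?P I card] by blast
  have finT: "finite T" using T fin finite_subset by blast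
  have finA: "finite (A i)" if "i \<in> T" for i using A T that \<open>finite X\<close> by (meson finite_subset subsetD)
  have surplus: "card K < card (\<Union>i\<in>K. A i)" if "K \<subset> T" "K \<noteq> {}" for K
    using least[of K] that T psubset_card_mono[OF finT that(1)] by (meson not_le subset_trans psubset_imp_subset)
  have tight: "card T \<le> card (\<Union>i\<in>T. A i)"
  proof -
    obtain i where i: "i \<in> T" using T by blast
    show ?thesis
    proof (cases "T = {i}")
      case True
      then show ?thesis using A[of i] T finA[OF i] by (simp add: Suc_le_eq card_gt_0_iff)
    next
      case False
      then have "card (T - {i}) < card (\<Union>l\<in>T - {i}. A l)" using i by (intro surplus) auto
      also have "\<dots> \<le> card (\<Union>l\<in>T. A l)" using finT finA by (intro card_mono) auto
      finally show ?thesis using i finT by simp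
    qed
  qed
  have "\<exists>\<sigma>. inj_on \<sigma> T \<and> (\<forall>i\<in>T. \<sigma> i \<in> A i)"
  proof (rule hall_distinct_representatives[OF finT finA])
    fix K assume "K \<subseteq> T"
    then show "card K \<le> card (\<Union>i\<in>K. A i)"
      using tight surplus[of K] by (cases "K = {}") (auto simp: psubset_eq intro: less_imp_le)
  qed
  then obtain \<sigma> where \<sigma>: "inj_on \<sigma> T" "\<forall>i\<in>T. \<sigma> i \<in> A i" by blast
  have "\<sigma> ` T = (\<Union>i\<in>T. A i)"
  proof (rule card_seteq)
    show "finite (\<Union>i\<in>T. A i)" using finT finA by auto
    show "\<sigma> ` T \<subseteq> (\<Union>i\<in>T. A i)" using \<sigma> by auto
    show "card (\<Union>i\<in>T. A i) \<le> card (\<sigma> ` T)" using T \<sigma> by (simp add: card_image)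
  qed
  then show ?thesis using \<sigma> T by blast
qed

lemma disjoint_subsets_of_card:
  assumes "finite I" and "finite J" and "card I * p \<le> card J"
  shows "\<exists>G. disjoint_family_on G I \<and> (\<forall>i\<in>I. G i \<subseteq> J \<and> card (G i) = p)"
  using assms
proof (induction I arbitrary: J rule: finite_induct)
  case empty
  then show ?case by (auto simp: disjoint_family_on_def)
next
  case (insert i I)
  then have "p \<le> card J" by simp
  then obtain S where S: "S \<subseteq> J" "card S = p" by (metis obtain_subset_with_card_n)
  have "card I * p \<le> card (J - S)"
    using insert S by (simp add: card_Diff_subset finite_subset)
  then obtain G where G: "disjoint_family_on G I" "\<forall>l\<in>I. G l \<subseteq> J - S \<and> card (G l) = p"
    using insert.IH[of "J - S"] insert.prems by auto
  have "disjoint_family_on (G(i := S)) (insert i I)"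
    using G insert.hyps unfolding disjoint_family_on_def by (auto; fastforce)
  moreover have "\<forall>l\<in>insert i I. (G(i := S)) l \<subseteq> J \<and> card ((G(i := S)) l) = p" using G S by auto
  ultimately show ?case by blast
qed

lemma subset_of_at_least_average_sum:
  fixes f :: "'a \<Rightarrow> real" and c :: real
  assumes "finite J" and "q \<le> card J" and "c * card J \<le> sum f J"
  shows "\<exists>T\<subseteq>J. card T = q \<and> c * q \<le> sum f T"
  using assms
proof (induction "card J" arbitrary: J)
  case 0
  then show ?case by auto
next
  case (Suc d)
  show ?case
  proof (cases "q = card J")
    case False
    obtain j where j: "j \<in> J" "\<forall>l\<in>J. f j \<le> f l"
      using Suc.hyps(2) Suc.prems(1) by (metis arg_min_if_finite(1) arg_min_least card.empty nat.simps(3))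
    have card: "card (J - {j}) = d" using Suc j by simp
    have "c * real (card (J - {j})) \<le> sum f (J - {j})"
    proof (cases "f j \<le> c")
      case True
      have "sum f (J - {j}) = sum f J - f j" using j Suc.prems by (simp add: sum_diff1)
      moreover have "real (card J) = real d + 1" using Suc.hyps(2) by simp
      ultimately show ?thesis using True Suc.prems(3) card by (simp add: algebra_simps)
    next
      case False
      then have "(\<Sum>l\<in>J - {j}. c) \<le> sum f (J - {j})"
        using j by (intro sum_mono) (meson DiffD1 less_eq_real_def not_le order_trans)
      then show ?thesis by (simp add: mult.commute)
    qed
    then have "\<exists>T\<subseteq>J - {j}. card T = q \<and> c * q \<le> sum f T"
      using Suc.hyps(2) Suc.prems False card by (intro Suc.hyps(1)) auto
    then show ?thesis by blast
  next
    case True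
    then show ?thesis using Suc.prems by auto
  qed
qed

section \<open>Value-measures as Borel measures without atoms\<close>

locale atomless_borel_measure = finite_borel_measure +
  assumes atomless: "measure M {x} = 0"
begin

lemma borel_in_sets: "A \<in> sets borel \<Longrightarrow> A \<in> sets M"
  by (simp add: M_is_borel)

text \<open>
  The intermediate value theorem for the distribution function of the measure restricted to \<open>D\<close>, which
  is continuous because the measure has no atoms.
\<close>
lemma prefix_of_given_measure:
  assumes D: "D \<in> sets borel" "bounded D" and y: "0 \<le> y" "y \<le> measure M D"
  shows "\<exists>t. measure M (D \<inter> {..t}) = y"
proof -
  let ?N = "density M (indicator D)"
  have N: "emeasure ?N X = emeasure M (D \<inter> X)" if "X \<in> sets borel" for X
    using D that by (intro emeasure_restricted borel_in_sets) auto
  have N': "measure ?N X = measure M (D \<inter> X)" if "X \<in> sets borel" for X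
    using N[OF that] by (simp add: measure_def)
  interpret N: finite_borel_measure ?N
  proof (intro finite_borel_measure.intro finite_measureI finite_borel_measure_axioms.intro)
    show "emeasure ?N (space ?N) \<noteq> \<infinity>"
      using N[of UNIV] by (simp add: borel_UNIV)
  qed (simp add: M_is_borel)
  have cdf: "cdf ?N t = measure M (D \<inter> {..t})" for t
    by (simp add: cdf_def N')
  have cont: "isCont (cdf ?N) t" for t
  proof -
    have "measure M (D \<inter> {t}) \<le> measure M {t}"
      by (intro finite_measure_mono borel_in_sets) auto
    then show ?thesis using atomless[of t] by (simp add: N.isCont_cdf N' measure_le_0_iff)
  qed
  obtain b where b: "\<And>x. x \<in> D \<Longrightarrow> \<bar>x\<bar> \<le> b" 
    using \<open>bounded D\<close> by (auto simp: bounded_iff)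
  define B where "B = \<bar>b\<bar> + 1"
  have "D \<inter> {..B} = D" "D \<inter> {..-B} = {}" using b by (force simp: B_def)+
  then have "\<exists>t\<ge>-B. t \<le> B \<and> cdf ?N t = y"
    using y cont by (intro IVT) (simp_all add: cdf[symmetric], simp_all add: cdf B_def)
  then show ?thesis using cdf by auto
qed

end

text \<open>
  The density of a value-measure is only controlled on \<open>C\<close> and only Lebesgue measurable. Cutting it off
  outside \<open>C\<close> gives a nonnegative integrable function on the whole line, and the measure with this
  density is then pushed forward from the Lebesgue sets to the Borel sets, where distribution functions
  are available; all portions are Borel sets.
\<close>
lemma value_measure_as_borel_measure:
  assumes V: "value_measure C V" and C: "C \<in> sets borel"
  obtains M where "atomless_borel_measure M"
    and "\<And>Z. Z \<in> sets borel \<Longrightarrow> Z \<subseteq> C \<Longrightarrow> V Z = measure M Z"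
proof -
  obtain v where v: "\<And>x. x \<in> C \<Longrightarrow> 0 \<le> v x" "set_integrable lebesgue C v"
    "\<And>Z. Z \<in> sets lebesgue \<Longrightarrow> Z \<subseteq> C \<Longrightarrow> V Z = (LINT x:Z|lebesgue. v x)"
    using V unfolding value_measure_def by metis
  define f where "f = (\<lambda>x. indicator C x * v x)"
  have f: "integrable lebesgue f" "f x \<ge> 0" for x
    using v(1,2) by (simp_all add: f_def set_integrable_def split: split_indicator)
  have fA: "integrable lebesgue (\<lambda>x. f x * indicator A x)" if "A \<in> sets borel" for A
    using that f(1) by (intro integrable_real_mult_indicator) auto
  define M where "M = distr (density lebesgue (\<lambda>x. ennreal (f x))) borel (\<lambda>x. x)"
  have M_emeasure: "emeasure M A = ennreal (LINT x|lebesgue. f x * indicator A x)" if A: "A \<in> sets borel" for A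
  proof -
    have "emeasure M A = emeasure (density lebesgue (\<lambda>x. ennreal (f x))) A"
      using A unfolding M_def by (subst emeasure_distr) (auto intro: measurable_completion)
    also have "\<dots> = (\<integral>\<^sup>+x. ennreal (f x) * indicator A x \<partial>lebesgue)"
      using f(1) A by (intro emeasure_density) auto
    also have "\<dots> = (\<integral>\<^sup>+x. ennreal (f x * indicator A x) \<partial>lebesgue)"
      by (intro nn_integral_cong) (auto simp: indicator_def)
    also have "\<dots> = ennreal (LINT x|lebesgue. f x * indicator A x)"
      using fA[OF A] f(2) by (intro nn_integral_eq_integral) auto
    finally show ?thesis .
  qed
  have M_measure: "measure M A = (LINT x|lebesgue. f x * indicator A x)" if "A \<in> sets borel" for A
    using f(2) by (simp add: measure_def M_emeasure[OF that])
  have "atomless_borel_measure M"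
  proof (intro atomless_borel_measure.intro atomless_borel_measure_axioms.intro
      finite_borel_measure.intro finite_measureI finite_borel_measure_axioms.intro)
    show "emeasure M (space M) \<noteq> \<infinity>" using M_emeasure[of UNIV] by (simp add: M_def)
    show "sets M = sets borel" by (simp add: M_def)
    show "measure M {x} = 0" for x
    proof -
      have "AE y in lebesgue. y \<noteq> x" by (intro AE_completion AE_lborel_singleton)
      then have "(LINT y|lebesgue. f y * indicator {x} y) = 0"
        by (intro integral_eq_zero_AE) (auto elim!: eventually_mono)
      then show ?thesis by (simp add: M_measure)
    qed
  qed
  moreover have "V Z = measure M Z" if "Z \<in> sets borel" "Z \<subseteq> C" for Z
  proof -
    have "V Z = (LINT x:Z|lebesgue. v x)" using that by (intro v(3)) auto
    also have "\<dots> = (LINT x|lebesgue. f x * indicator Z x)"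
      unfolding set_lebesgue_integral_def using that(2)
      by (intro Bochner_Integration.integral_cong) (auto simp: f_def indicator_def)
    finally show ?thesis using M_measure[OF that(1)] by simp
  qed
  ultimately show ?thesis using that by blast
qed

section \<open>Serving all agents by repeated reduction\<close>

text \<open>
  The pieces available to one agent, relative to any family \<open>\<F>\<close> of sets in place of the islands, since
  the family shrinks while agents are served.
\<close>
definition portion :: "nat \<Rightarrow> real set set \<Rightarrow> real set \<Rightarrow> bool" where
  "portion k \<F> Z \<longleftrightarrow> (\<exists>\<J>. finite \<J> \<and> card \<J> \<le> k \<and> Z = \<Union>\<J> \<and>
     (\<forall>I\<in>\<J>. is_interval I \<and> (\<exists>D\<in>\<F>. I \<subseteq> D)))"

lemma feasible_iff_portion: "feasible Islands k n Z \<longleftrightarrow> (\<forall>i\<in>{1..n}. portion k Islands (Z i))"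
  by (simp add: feasible_def portion_def)

lemma portion_subset: "portion k \<F> Z \<Longrightarrow> Z \<subseteq> \<Union>\<F>"
  unfolding portion_def by blast

lemma portion_refine: "portion k \<F> Z \<Longrightarrow> (\<And>D. D \<in> \<F> \<Longrightarrow> \<exists>E\<in>\<E>. D \<subseteq> E) \<Longrightarrow> portion k \<E> Z"
  unfolding portion_def by (elim exE conjE, intro exI conjI, assumption+) (meson subset_trans)

lemma portion_borel: "portion k \<F> Z \<Longrightarrow> Z \<in> sets borel"
  unfolding portion_def by (auto intro: sets.finite_Union real_interval_borel_measurable)

text \<open>
  Some nonempty group \<open>R\<close> of agents can leave with satisfactory portions \<open>B\<close>, so that the rest of the
  cake is a union of intervals \<open>D' j\<close>, of which there are \<open>p\<close> fewer for each departing agent, and each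
  departing agent costs every remaining agent \<open>i\<close> at most \<open>(p + 1) * c i\<close>. With \<open>k = p + 1\<close>, one departing
  agent lowers the number of islands plus the number of agents by \<open>k\<close>, so the invariant
  \<open>V i \<ge> c i * (number of islands + number of agents - 1)\<close> survives.
\<close>
definition reducible ::
  "nat \<Rightarrow> ('i \<Rightarrow> real measure) \<Rightarrow> ('i \<Rightarrow> real) \<Rightarrow> ('j \<Rightarrow> real set) \<Rightarrow> 'i set \<Rightarrow> 'j set \<Rightarrow> bool" where
  "reducible p M c D N J \<longleftrightarrow> (\<exists>R B J' D'. R \<subseteq> N \<and> R \<noteq> {} \<and> J' \<subseteq> J \<and> card J = card J' + card R * p \<and>
     disjoint_family_on B R \<and>
     (\<forall>i\<in>R. portion (Suc p) (D ` J) (B i) \<and> real (Suc p) * c i \<le> measure (M i) (B i)) \<and>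
     (\<forall>j\<in>J'. is_interval (D' j) \<and> D' j \<subseteq> D j) \<and>
     (\<Union>j\<in>J'. D' j) = (\<Union>j\<in>J. D j) - (\<Union>i\<in>R. B i) \<and>
     (\<forall>i\<in>N - R. \<forall>l\<in>R. measure (M i) (B l) \<le> real (Suc p) * c i))"

text \<open>
  If every \<open>p\<close> islands satisfy someone, split off as many groups of \<open>p\<close> whole islands as there are
  agents and match groups to agents whom they satisfy. Envy-freeness of the matching says that the agents
  left over find each assigned group too small, which bounds their loss.
\<close>
lemma reducible_by_groups:
  assumes fin: "finite N" "N \<noteq> {}" "finite J"
    and disj: "disjoint_family_on D J" and int: "\<And>j. j \<in> J \<Longrightarrow> is_interval (D j)"
    and many: "card N * p \<le> card J"
    and wanted: "\<And>S. S \<subseteq> J \<Longrightarrow> card S = p \<Longrightarrow> \<exists>i\<in>N. real (Suc p) * c i \<le> measure (M i) (\<Union>j\<in>S. D j)"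
  shows "reducible p M c D N J"
proof -
  obtain G where G: "disjoint_family_on G N" "\<And>g. g \<in> N \<Longrightarrow> G g \<subseteq> J \<and> card (G g) = p"
    using disjoint_subsets_of_card[OF fin(1,3) many] by blast
  define U where "U g = (\<Union>j\<in>G g. D j)" for g
  define A where "A g = {i\<in>N. real (Suc p) * c i \<le> measure (M i) (U g)}" for g
  \<comment> \<open>The agents \<open>N\<close> also serve as the names of the groups, so there are equally many of both.\<close>
  have "A g \<subseteq> N \<and> A g \<noteq> {}" if "g \<in> N" for g
    using wanted[of "G g"] G(2)[OF that] by (auto simp: A_def U_def)
  then obtain T \<sigma> where T: "T \<subseteq> N" "T \<noteq> {}" and \<sigma>: "inj_on \<sigma> T" "\<And>g. g \<in> T \<Longrightarrow> \<sigma> g \<in> A g"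
      "\<sigma> ` T = (\<Union>g\<in>T. A g)"
    using envy_free_matching[of N N A] fin by blast
  define R where "R = \<sigma> ` T"
  define \<tau> where "\<tau> = the_inv_into T \<sigma>"
  have \<tau>: "\<tau> i \<in> T" "\<sigma> (\<tau> i) = i" if "i \<in> R" for i
    using that \<sigma>(1) by (auto simp: R_def \<tau>_def the_inv_into_f_f)
  have GT: "G (\<tau> i) \<subseteq> J" "card (G (\<tau> i)) = p" if "i \<in> R" for i using G(2) \<tau>(1)[OF that] T(1) by auto
  have G_disj: "disjoint_family_on (\<lambda>i. G (\<tau> i)) R"
    unfolding disjoint_family_on_def
  proof (intro ballI impI)
    fix a b assume ab: "a \<in> R" "b \<in> R" "a \<noteq> b"
    then have "\<tau> a \<noteq> \<tau> b" using \<tau>(2) by metis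
    then show "G (\<tau> a) \<inter> G (\<tau> b) = {}"
      using G(1) \<tau>(1) ab T(1) by (meson disjoint_family_onD subsetD)
  qed
  define B where "B i = U (\<tau> i)" for i
  define J' where "J' = J - (\<Union>i\<in>R. G (\<tau> i))"
  have finR: "finite R" using T(1) fin(1) finite_subset by (auto simp: R_def)
  have finG: "finite (G (\<tau> i))" if "i \<in> R" for i using GT(1)[OF that] fin(3) finite_subset by blast
  have "card (\<Union>i\<in>R. G (\<tau> i)) = card R * p"
    using finR finG G_disj GT(2) by (subst card_UN_disjoint) (auto simp: disjoint_family_on_def)
  moreover have "card J = card J' + card (\<Union>i\<in>R. G (\<tau> i))"
    using GT(1) fin(3) finR finG by (subst card_Un_disjoint[symmetric]) (auto simp: J'_def intro!: arg_cong[of _ _ card])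
  ultimately have "card J = card J' + card R * p" by simp
  moreover have "disjoint_family_on B R"
    unfolding disjoint_family_on_def B_def U_def
  proof (intro ballI impI)
    fix a b assume ab: "a \<in> R" "b \<in> R" "a \<noteq> b"
    then have "G (\<tau> a) \<inter> G (\<tau> b) = {}" using G_disj by (meson disjoint_family_onD)
    then have "D x \<inter> D y = {}" if "x \<in> G (\<tau> a)" "y \<in> G (\<tau> b)" for x y
      using that GT(1) ab by (intro disjoint_family_onD[OF disj]) auto
    then show "(\<Union>j\<in>G (\<tau> a). D j) \<inter> (\<Union>j\<in>G (\<tau> b). D j) = {}" by blast
  qed
  moreover have "portion (Suc p) (D ` J) (B i)" if "i \<in> R" for i
    unfolding portion_def
  proof (intro exI[of _ "D ` G (\<tau> i)"] conjI)
    show "card (D ` G (\<tau> i)) \<le> Suc p"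
      using card_image_le[OF finG[OF that], of D] GT(2)[OF that] by simp
  qed (use GT(1)[OF that] finG[OF that] int in \<open>auto simp: B_def U_def\<close>)
  moreover have "real (Suc p) * c i \<le> measure (M i) (B i)" if "i \<in> R" for i
    using \<sigma>(2)[OF \<tau>(1)[OF that]] \<tau>(2)[OF that] by (simp add: A_def B_def)
  moreover have "(\<Union>j\<in>J'. D j) = (\<Union>j\<in>J. D j) - (\<Union>i\<in>R. B i)"
    using disj GT(1) by (fastforce simp: J'_def B_def U_def disjoint_family_on_def)
  moreover have "measure (M i) (B l) \<le> real (Suc p) * c i" if "i \<in> N - R" "l \<in> R" for i l
  proof -
    have "i \<notin> A (\<tau> l)" using that \<sigma>(3) \<tau>(1) by (auto simp: R_def)
    then show ?thesis using that by (auto simp: A_def B_def)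
  qed
  moreover have "R \<subseteq> N" using \<sigma>(2) by (auto simp: R_def A_def)
  moreover have "R \<noteq> {}" "J' \<subseteq> J" using T(2) by (auto simp: R_def J'_def)
  moreover have "\<forall>j\<in>J'. is_interval (D j) \<and> D j \<subseteq> D j" using int by (auto simp: J'_def)
  ultimately show ?thesis
    unfolding reducible_def by (intro exI[of _ R] exI[of _ B] exI[of _ J'] exI[of _ D]) auto
qed

text \<open>
  The islands \<open>S\<close> satisfy nobody, but together with the island \<open>j\<close> they satisfy some agent. Moving a
  knife along \<open>j\<close>, the first agent \<open>b\<close> to be satisfied takes \<open>S\<close> and the part of \<open>j\<close> to the left of
  the knife; all others value this portion at no more than their share. It uses \<open>p + 1\<close> intervals but
  removes only \<open>p\<close> islands, as the rest of \<open>j\<close> remains one interval.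
\<close>
lemma reducible_by_cut:
  assumes fin: "finite N" "finite J"
    and M: "\<And>i. i \<in> N \<Longrightarrow> atomless_borel_measure (M i)"
    and disj: "disjoint_family_on D J" and int: "\<And>j. j \<in> J \<Longrightarrow> is_interval (D j) \<and> bounded (D j)"
    and S: "S \<subseteq> J" "card S = p" and j: "j \<in> J - S"
    and small: "\<And>i. i \<in> N \<Longrightarrow> measure (M i) (\<Union>l\<in>S. D l) < real (Suc p) * c i"
    and big: "a \<in> N" "real (Suc p) * c a \<le> measure (M a) (\<Union>l\<in>insert j S. D l)"
  shows "reducible p M c D N J"
proof -
  define P where "P t = (\<Union>l\<in>S. D l) \<union> (D j \<inter> {..t})" for t
  have finS: "finite S" using S(1) fin(2) finite_subset by blast
  have Dj: "D j \<in> sets borel" "bounded (D j)" using j int real_interval_borel_measurable by auto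
  have US: "(\<Union>l\<in>S. D l) \<in> sets borel"
    using finS S(1) int by (intro sets.finite_UN real_interval_borel_measurable) auto
  have apart: "(\<Union>l\<in>S. D l) \<inter> D j = {}"
    using disj j S(1) by (force simp: disjoint_family_on_def)
  have mP: "measure (M i) (P t) = measure (M i) (\<Union>l\<in>S. D l) + measure (M i) (D j \<inter> {..t})"
    if "i \<in> N" for i t
  proof -
    interpret atomless_borel_measure "M i" using M[OF that] .
    show ?thesis unfolding P_def
      using US Dj apart by (intro finite_measure_Union borel_in_sets) auto
  qed
  have mono: "measure (M i) (P s) \<le> measure (M i) (P t)" if "i \<in> N" "s \<le> t" for i s t
  proof -
    interpret atomless_borel_measure "M i" using M[OF that(1)] .
    show ?thesis unfolding P_def
      using US Dj that(2) by (intro finite_measure_mono borel_in_sets) auto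
  qed
  define N1 where "N1 = {i\<in>N. real (Suc p) * c i \<le> measure (M i) (\<Union>l\<in>insert j S. D l)}"
  have "\<exists>t. measure (M i) (P t) = real (Suc p) * c i" if "i \<in> N1" for i
  proof -
    have iN: "i \<in> N" using that by (simp add: N1_def)
    interpret atomless_borel_measure "M i" using M[OF iN] .
    have "measure (M i) (\<Union>l\<in>insert j S. D l) = measure (M i) (\<Union>l\<in>S. D l) + measure (M i) (D j)"
      using US Dj apart by (subst finite_measure_Union[symmetric]) (auto intro!: borel_in_sets simp: Un_commute)
    then have "\<exists>t. measure (M i) (D j \<inter> {..t}) = real (Suc p) * c i - measure (M i) (\<Union>l\<in>S. D l)"
      using that small[OF iN] Dj by (intro prefix_of_given_measure) (auto simp: N1_def)
    then show ?thesis using mP[OF iN] by (metis add.commute diff_add_cancel)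
  qed
  then obtain \<theta> where \<theta>: "\<And>i. i \<in> N1 \<Longrightarrow> measure (M i) (P (\<theta> i)) = real (Suc p) * c i" by metis
  have "finite N1" "N1 \<noteq> {}" using fin(1) big by (auto simp: N1_def)
  then obtain b where b: "b \<in> N1" "\<And>i. i \<in> N1 \<Longrightarrow> \<theta> b \<le> \<theta> i"
    by (metis arg_min_if_finite(1) arg_min_least)
  have bN: "b \<in> N" using b(1) by (simp add: N1_def)
  define t where "t = \<theta> b"
  define J' where "J' = J - S"
  define D' where "D' = D(j := D j - {..t})"
  have "measure (M i) (P t) \<le> real (Suc p) * c i" if "i \<in> N" for i
  proof (cases "i \<in> N1")
    case True
    then show ?thesis using mono[OF that b(2)[OF True]] \<theta> by (simp add: t_def)
  next
    case False
    interpret atomless_borel_measure "M i" using M[OF that] .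
    have "measure (M i) (P t) \<le> measure (M i) (\<Union>l\<in>insert j S. D l)"
      unfolding P_def using US Dj by (intro finite_measure_mono borel_in_sets) auto
    then show ?thesis using False that by (simp add: N1_def)
  qed
  moreover have "real (Suc p) * c b \<le> measure (M b) (P t)" using \<theta>[OF b(1)] by (simp add: t_def)
  moreover have "portion (Suc p) (D ` J) (P t)"
    unfolding portion_def
  proof (intro exI[of _ "insert (D j \<inter> {..t}) (D ` S)"] conjI)
    show "card (insert (D j \<inter> {..t}) (D ` S)) \<le> Suc p"
      using card_insert_le_m1 card_image_le[OF finS, of D] S(2) finS by (auto simp: card_insert_if)
    show "\<forall>I\<in>insert (D j \<inter> {..t}) (D ` S). is_interval I \<and> (\<exists>E\<in>D ` J. I \<subseteq> E)"
      using S(1) j int by (auto intro!: is_interval_Int)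
  qed (auto simp: P_def finS)
  moreover have "card J = card J' + card {b} * p"
    using S fin(2) finS card_mono[OF fin(2) S(1)] by (simp add: J'_def card_Diff_subset)
  moreover have "is_interval (D' l) \<and> D' l \<subseteq> D l" if "l \<in> J'" for l
  proof -
    have "is_interval (D j \<inter> {t<..})" using j int by (intro is_interval_Int) auto
    moreover have "D j - {..t} = D j \<inter> {t<..}" by auto
    ultimately show ?thesis using that int by (auto simp: D'_def J'_def)
  qed
  moreover have "(\<Union>l\<in>J'. D' l) = (\<Union>l\<in>J. D l) - P t"
  proof -
    have "x \<notin> D l" if "l \<in> J" "l' \<in> J" "l \<noteq> l'" "x \<in> D l'" for x l l'
      using disj that by (auto simp: disjoint_family_on_def)
    then show ?thesis using j S(1)
      unfolding J'_def D'_def P_def by (auto split: if_splits; blast)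
  qed
  ultimately show ?thesis
    unfolding reducible_def using bN
    by (intro exI[of _ "{b}"] exI[of _ "\<lambda>_. P t"] exI[of _ J'] exI[of _ D'])
       (auto simp: J'_def disjoint_family_on_def)
qed

text \<open>
  If some \<open>p\<close> islands satisfy nobody, then the hypotheses of the cut hold for a suitable choice of
  them: fix an agent \<open>a\<close> and \<open>p + 1\<close> islands \<open>T\<close> of at least average value to \<open>a\<close>, hence satisfying \<open>a\<close>,
  and choose the unsatisfactory set \<open>S\<close> to share as many islands as possible with \<open>T\<close>. If adding an
  island \<open>j\<close> of \<open>T - S\<close> still satisfied nobody, then exchanging an island of \<open>S - T\<close> for \<open>j\<close> would
  contradict the choice of \<open>S\<close>; and if \<open>S - T\<close> is empty, then \<open>S\<close> with \<open>j\<close> is \<open>T\<close>, which satisfies \<open>a\<close>.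
\<close>
lemma reducible:
  assumes fin: "finite N" "N \<noteq> {}" "finite J"
    and M: "\<And>i. i \<in> N \<Longrightarrow> atomless_borel_measure (M i)"
    and c: "\<And>i. i \<in> N \<Longrightarrow> 0 \<le> c i"
    and disj: "disjoint_family_on D J" and int: "\<And>j. j \<in> J \<Longrightarrow> is_interval (D j) \<and> bounded (D j)"
    and many: "card N * p < card J"
    and total: "\<And>i. i \<in> N \<Longrightarrow> c i * (real (card J) + real (card N) - 1) \<le> measure (M i) (\<Union>j\<in>J. D j)"
  shows "reducible p M c D N J"
proof (cases "\<forall>S. S \<subseteq> J \<longrightarrow> card S = p \<longrightarrow> (\<exists>i\<in>N. real (Suc p) * c i \<le> measure (M i) (\<Union>j\<in>S. D j))")
  case True
  then show ?thesis using fin disj int many by (intro reducible_by_groups) auto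
next
  case False
  define small where "small S \<longleftrightarrow> (\<forall>i\<in>N. measure (M i) (\<Union>j\<in>S. D j) < real (Suc p) * c i)" for S
  let ?Q = "\<lambda>S. S \<subseteq> J \<and> card S = p \<and> small S"
  have "Ex ?Q" using False by (auto simp: small_def not_le)
  obtain a where a: "a \<in> N" using fin by blast
  interpret a: atomless_borel_measure "M a" using M[OF a] .
  have UN_measure: "measure (M a) (\<Union>j\<in>T. D j) = (\<Sum>j\<in>T. measure (M a) (D j))" if "T \<subseteq> J" for T
    using that fin(3) disj int
    by (intro a.finite_measure_finite_Union)
       (auto intro: finite_subset disjoint_family_on_mono a.borel_in_sets real_interval_borel_measurable)
  have "1 * p \<le> card N * p" using fin by (intro mult_right_mono) (auto simp: Suc_le_eq card_gt_0_iff)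
  then have "Suc p \<le> card J" using many by linarith
  moreover have "c a * real (card J) \<le> c a * (real (card J) + real (card N) - 1)"
    using c[OF a] fin by (intro mult_left_mono) (auto simp: Suc_le_eq card_gt_0_iff)
  then have "c a * real (card J) \<le> (\<Sum>j\<in>J. measure (M a) (D j))"
    using total[OF a] UN_measure[of J] by simp
  ultimately obtain T where T: "T \<subseteq> J" "card T = Suc p" "c a * real (Suc p) \<le> (\<Sum>j\<in>T. measure (M a) (D j))"
    using subset_of_at_least_average_sum[OF fin(3)] by blast
  then have Ta: "real (Suc p) * c a \<le> measure (M a) (\<Union>j\<in>T. D j)"
    using UN_measure by (simp add: mult.commute)
  have finT: "finite T" using T(1) fin(3) finite_subset by blast
  obtain S where S: "?Q S" and max: "\<And>S'. ?Q S' \<Longrightarrow> card (S' \<inter> T) \<le> card (S \<inter> T)"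
    using ex_has_greatest_nat[of ?Q _ "\<lambda>S. card (S \<inter> T)" "Suc (card T)"] \<open>Ex ?Q\<close> finT
    by (metis Int_lower2 card_mono le_imp_less_Suc)
  have finS: "finite S" using S fin(3) finite_subset by blast
  have "\<not> T \<subseteq> S" using card_mono[OF finS, of T] S T(2) by auto
  then obtain j where j: "j \<in> T" "j \<notin> S" by blast
  have "\<not> small (insert j S)"
  proof
    assume sm: "small (insert j S)"
    have anti: "small S'" if "S' \<subseteq> insert j S" for S'
    proof -
      have "measure (M i) (\<Union>l\<in>S'. D l) \<le> measure (M i) (\<Union>l\<in>insert j S. D l)" if "i \<in> N" for i
      proof -
        interpret atomless_borel_measure "M i" using M[OF that] .
        have "(\<Union>l\<in>insert j S. D l) \<in> sets borel"
          using finS j T(1) S int by (intro sets.finite_UN real_interval_borel_measurable) auto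
        then show ?thesis
          using \<open>S' \<subseteq> insert j S\<close> by (intro finite_measure_mono borel_in_sets) auto
      qed
      then show ?thesis using sm unfolding small_def by (meson le_less_trans)
    qed
    have "\<not> S \<subseteq> T"
    proof
      assume "S \<subseteq> T"
      then have "insert j S = T" using finT finS S T j by (intro card_subset_eq) auto
      then show False using sm Ta a by (auto simp: small_def not_less[symmetric])
    qed
    then obtain s where s: "s \<in> S" "s \<notin> T" by blast
    have "?Q (insert j (S - {s}))"
      using S s j T(1) finS card_gt_0_iff[of S] by (auto intro!: anti simp: card_Diff_singleton)
    then have "card (insert j (S - {s}) \<inter> T) \<le> card (S \<inter> T)" by (rule max)
    moreover have "insert j (S - {s}) \<inter> T = insert j (S \<inter> T)" using j s by auto
    ultimately show False using j finS by simp
  qed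
  then obtain b where "b \<in> N" "real (Suc p) * c b \<le> measure (M b) (\<Union>l\<in>insert j S. D l)"
    by (auto simp: small_def not_less)
  then show ?thesis
    using fin M disj int S j T(1) by (intro reducible_by_cut[of N J M D S p j c b]) (auto simp: small_def)
qed

text \<open>
  The agents' guaranteed shares \<open>c i\<close> are absolute amounts, so agents to whom the cake is worthless need
  no separate treatment. The sets \<open>D j\<close> may have any length and may be empty: the induction cuts islands,
  and the application pads a multicake with empty ones.
\<close>
lemma fair_portions:
  assumes "finite N" "finite J"
    and "\<And>i. i \<in> N \<Longrightarrow> atomless_borel_measure (M i)"
    and "\<And>i. i \<in> N \<Longrightarrow> 0 \<le> c i"
    and "disjoint_family_on D J" and "\<And>j. j \<in> J \<Longrightarrow> is_interval (D j) \<and> bounded (D j)"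
    and "card N * p < card J"
    and "\<And>i. i \<in> N \<Longrightarrow> c i * (real (card J) + real (card N) - 1) \<le> measure (M i) (\<Union>j\<in>J. D j)"
  shows "\<exists>Z. disjoint_family_on Z N \<and>
           (\<forall>i\<in>N. portion (Suc p) (D ` J) (Z i) \<and> real (Suc p) * c i \<le> measure (M i) (Z i))"
  using assms
proof (induction "card N" arbitrary: N J D rule: less_induct)
  case less
  note fin = less.prems(1,2) and M = less.prems(3) and int = less.prems(6)
  show ?case
  proof (cases "N = {}")
    case False
    then have "reducible p M c D N J" using less.prems by (intro reducible) auto
    then obtain R B J' D' where R: "R \<subseteq> N" "R \<noteq> {}" and J': "J' \<subseteq> J" "card J = card J' + card R * p"
      and B: "disjoint_family_on B R"
        "\<forall>i\<in>R. portion (Suc p) (D ` J) (B i) \<and> real (Suc p) * c i \<le> measure (M i) (B i)"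
      and D': "\<forall>j\<in>J'. is_interval (D' j) \<and> D' j \<subseteq> D j"
      and rest: "(\<Union>j\<in>J'. D' j) = (\<Union>j\<in>J. D j) - (\<Union>i\<in>R. B i)"
      and lost: "\<forall>i\<in>N - R. \<forall>l\<in>R. measure (M i) (B l) \<le> real (Suc p) * c i"
      unfolding reducible_def by (elim exE conjE)
    note B = B(1) B(2)[rule_format] and D' = D'[rule_format] and lost = lost[rule_format]
    have finR: "finite R" using R(1) fin(1) finite_subset by blast
    have cN: "card N = card (N - R) + card R"
      using R(1) finR card_mono[OF fin(1) R(1)] by (simp add: card_Diff_subset)
    have "card R > 0" using R(2) finR by (simp add: card_gt_0_iff)
    have "\<exists>Z. disjoint_family_on Z (N - R) \<and>
        (\<forall>i\<in>N - R. portion (Suc p) (D' ` J') (Z i) \<and> real (Suc p) * c i \<le> measure (M i) (Z i))"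
    proof (rule less.hyps)
      show "card (N - R) < card N" using cN \<open>card R > 0\<close> by simp
      show "finite J'" using J'(1) fin(2) finite_subset by blast
      show "disjoint_family_on D' J'"
        using less.prems(5) J'(1) D' unfolding disjoint_family_on_def by (meson disjoint_iff subsetD)
      show "is_interval (D' j) \<and> bounded (D' j)" if "j \<in> J'" for j
        using D'[OF that] int J'(1) that bounded_subset by blast
      show "card (N - R) * p < card J'"
        using less.prems(7) unfolding cN J'(2) by (simp add: algebra_simps)
      show "c i * (real (card J') + real (card (N - R)) - 1) \<le> measure (M i) (\<Union>j\<in>J'. D' j)"
        if i: "i \<in> N - R" for i
      proof -
        interpret atomless_borel_measure "M i" using M i by auto
        have Bm: "B l \<in> sets (M i)" if "l \<in> R" for l
          using B(2)[OF that] portion_borel by (auto intro: borel_in_sets)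
        have Dm: "(\<Union>j\<in>J. D j) \<in> sets (M i)"
          using fin(2) int by (intro sets.finite_UN borel_in_sets real_interval_borel_measurable) auto
        have "measure (M i) (\<Union>l\<in>R. B l) \<le> (\<Sum>l\<in>R. measure (M i) (B l))"
          using finR Bm by (intro finite_measure_subadditive_finite) auto
        also have "\<dots> \<le> (\<Sum>l\<in>R. real (Suc p) * c i)" using lost i by (intro sum_mono) auto
        finally have "measure (M i) (\<Union>l\<in>R. B l) \<le> real (card R) * (real (Suc p) * c i)" by simp
        moreover have "(\<Union>l\<in>R. B l) \<subseteq> (\<Union>j\<in>J. D j)"
          using B(2) portion_subset by blast
        then have "measure (M i) (\<Union>j\<in>J'. D' j) = measure (M i) (\<Union>j\<in>J. D j) - measure (M i) (\<Union>l\<in>R. B l)"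
          unfolding rest using Dm Bm finR by (intro finite_measure_Diff) auto
        moreover have "c i * (real (card J) + real (card N) - 1) \<le> measure (M i) (\<Union>j\<in>J. D j)"
          using less.prems(8) i by auto
        ultimately show ?thesis unfolding cN J'(2) by (simp add: algebra_simps)
      qed
    qed (use less.prems in auto)
    then obtain Z where Z: "disjoint_family_on Z (N - R)"
      "\<And>i. i \<in> N - R \<Longrightarrow> portion (Suc p) (D' ` J') (Z i) \<and> real (Suc p) * c i \<le> measure (M i) (Z i)" by blast
    have Zsub: "Z i \<subseteq> (\<Union>j\<in>J. D j) - (\<Union>i\<in>R. B i)" if "i \<in> N - R" for i
      using Z(2)[OF that] portion_subset unfolding rest[symmetric] by blast
    have ZB: "Z i \<inter> B l = {}" if "i \<in> N - R" "l \<in> R" for i l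
      using Zsub[OF that(1)] that(2) by blast
    let ?Y = "\<lambda>i. if i \<in> R then B i else Z i"
    have "disjoint_family_on ?Y N"
      unfolding disjoint_family_on_def
    proof (intro ballI impI)
      fix i l assume "i \<in> N" "l \<in> N" "i \<noteq> l"
      then show "?Y i \<inter> ?Y l = {}"
        using B(1) Z(1) ZB[of i l] ZB[of l i] by (auto simp: disjoint_family_on_def)
    qed
    moreover have "portion (Suc p) (D ` J) (Z i)" if "i \<in> N - R" for i
    proof (rule portion_refine)
      show "portion (Suc p) (D' ` J') (Z i)" using Z(2)[OF that] by simp
      show "\<exists>E\<in>D ` J. A \<subseteq> E" if "A \<in> D' ` J'" for A
        using that D' J'(1) by blast
    qed
    ultimately show ?thesis using B(2) Z(2) by (intro exI[of _ ?Y]) auto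
  qed (auto simp: disjoint_family_on_def)
qed

section \<open>The guaranteed ratio\<close>

lemma bounded_interval_of_unit_length:
  fixes D :: "real set"
  assumes D: "is_interval D" "measure lborel D = 1"
  shows "bounded D"
proof -
  have "D \<noteq> {}" using D(2) by auto
  then obtain p where p: "p \<in> D" by blast
  have "emeasure lborel D \<noteq> \<infinity>" using D(2) by (auto simp: measure_def)
  then have fm: "D \<in> fmeasurable lborel"
    using real_interval_borel_measurable[OF D(1)] by (auto simp: fmeasurable_def top.not_eq_extremum)
  have "dist p q \<le> 1" if "q \<in> D" for q
  proof -
    have "{min p q..max p q} \<subseteq> D" using D(1) p that 
      by (auto intro: mem_is_interval_1_I[of D p q] mem_is_interval_1_I[of D q p]
          simp: min_def max_def split: if_splits)
    then have "measure lborel {min p q..max p q} \<le> 1"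
      using fm D(2) by (metis measure_mono_fmeasurable atLeastAtMost_borel sets_lborel)
    then show ?thesis by (auto simp: dist_real_def min_def max_def split: if_splits)
  qed
  then show ?thesis unfolding bounded_def by blast
qed

text \<open>
  Empty islands are added until there are more than \<open>n * (k - 1)\<close> of them. If there were
  enough already, \<open>k / (m + n - 1)\<close> is the smaller of the two bounds; otherwise the new number \<open>m'\<close> of
  islands satisfies \<open>m' + n - 1 = n * k\<close>, and the share \<open>k / (m' + n - 1)\<close> is exactly \<open>1 / n\<close>.
\<close>
lemma guaranteed_min:
  assumes "m \<ge> 1" and "k \<ge> 1" and "n \<ge> 1"
  shows "guaranteed m k n (min (1 / real n) (real k / (real m + real n - 1)))"
  unfolding guaranteed_def
proof (intro allI impI)
  fix Islands :: "real set set" and V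
  assume mc: "multicake m Islands" and V: "\<forall>i\<in>{1..n}. value_measure (\<Union>Islands) (V i)"
  let ?r = "min (1 / real n) (real k / (real m + real n - 1))"
  let ?C = "\<Union>Islands"
  have Islands: "finite Islands" "card Islands = m" "disjoint Islands"
    "\<And>I. I \<in> Islands \<Longrightarrow> is_interval I \<and> bounded I"
    using mc bounded_interval_of_unit_length unfolding multicake_def by auto
  have C: "?C \<in> sets borel"
    using Islands by (intro sets.finite_Union) (auto intro: real_interval_borel_measurable)
  have "\<forall>i\<in>{1..n}. \<exists>M. atomless_borel_measure M \<and> (\<forall>Z. Z \<in> sets borel \<longrightarrow> Z \<subseteq> ?C \<longrightarrow> V i Z = measure M Z)"
    using V value_measure_as_borel_measure[OF _ C] by metis
  then obtain M where M: "\<And>i. i \<in> {1..n} \<Longrightarrow> atomless_borel_measure (M i)"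
    "\<And>i Z. i \<in> {1..n} \<Longrightarrow> Z \<in> sets borel \<Longrightarrow> Z \<subseteq> ?C \<Longrightarrow> V i Z = measure (M i) Z"
    by metis
  define m' where "m' = max m (n * (k - 1) + 1)"
  obtain f where f: "bij_betw f {0..<m} Islands"
    using ex_bij_betw_nat_finite[OF Islands(1)] Islands(2) by auto
  define D where "D j = (if j < m then f j else {})" for j
  have fI: "f j \<in> Islands" if "j < m" for j using f that by (auto simp: bij_betw_def)
  have UD: "(\<Union>j<m'. D j) = ?C"
  proof -
    have "?C = (\<Union>j\<in>{0..<m}. f j)" using f by (auto simp: bij_betw_def)
    also have "\<dots> = (\<Union>j\<in>{0..<m}. D j)" by (simp add: D_def)
    also have "\<dots> = (\<Union>j<m'. D j)"
      unfolding D_def m'_def by (intro equalityI UN_mono UN_least) (force split: if_splits)+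
    finally show ?thesis by simp
  qed
  have disj: "disjoint_family_on D {..<m'}"
    unfolding disjoint_family_on_def
  proof (intro ballI impI)
    fix a b :: nat assume "a \<noteq> b"
    then have "f a \<noteq> f b" if "a < m" "b < m" using f that by (auto simp: bij_betw_def inj_on_def)
    then show "D a \<inter> D b = {}"
      using disjointD[OF Islands(3), of "f a" "f b"] fI by (simp add: D_def)
  qed
  define c where "c i = V i ?C / (real m' + real n - 1)" for i
  have pos: "real m' + real n - 1 > 0" using assms by (simp add: m'_def)
  have VC: "V i ?C = measure (M i) ?C" if "i \<in> {1..n}" for i using M(2)[OF that C] by simp
  have "\<exists>Z. disjoint_family_on Z {1..n} \<and>
      (\<forall>i\<in>{1..n}. portion (Suc (k - 1)) (D ` {..<m'}) (Z i) \<and> real (Suc (k - 1)) * c i \<le> measure (M i) (Z i))"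
  proof (intro fair_portions M(1) disj)
    show "is_interval (D j) \<and> bounded (D j)" for j using Islands(4) fI by (auto simp: D_def)
    show "0 \<le> c i" if "i \<in> {1..n}" for i using pos VC[OF that] by (simp add: c_def)
    show "card {1..n} * (k - 1) < card {..<m'}" by (simp add: m'_def)
    show "c i * (real (card {..<m'}) + real (card {1..n}) - 1) \<le> measure (M i) (\<Union>j<m'. D j)"
      if "i \<in> {1..n}" for i
      using pos VC[OF that] by (simp add: c_def UD)
  qed auto
  then obtain Z where Z: "disjoint_family_on Z {1..n}"
    "\<And>i. i \<in> {1..n} \<Longrightarrow> portion k (D ` {..<m'}) (Z i) \<and> real k * c i \<le> measure (M i) (Z i)"
    using \<open>k \<ge> 1\<close> by auto
  have ZC: "Z i \<subseteq> ?C" "Z i \<in> sets borel" if "i \<in> {1..n}" for i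
    using Z(2)[OF that] portion_subset[of k "D ` {..<m'}" "Z i"] portion_borel UD by auto
  have "Islands \<noteq> {}" using Islands(2) \<open>m \<ge> 1\<close> by auto
  have "allocation ?C n Z" using Z(1) ZC(1) by (simp add: allocation_def)
  moreover have "feasible Islands k n Z"
    unfolding feasible_iff_portion
  proof
    fix i assume i: "i \<in> {1..n}"
    show "portion k Islands (Z i)"
    proof (rule portion_refine)
      show "portion k (D ` {..<m'}) (Z i)" using Z(2)[OF i] by simp
      fix E assume "E \<in> D ` {..<m'}"
      then obtain j where "E = D j" by blast
      then show "\<exists>F\<in>Islands. E \<subseteq> F" using fI[of j] \<open>Islands \<noteq> {}\<close> by (cases "j < m") (auto simp: D_def)
    qed
  qed
  moreover have "V i (Z i) \<ge> ?r * V i ?C" if i: "i \<in> {1..n}" for i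
  proof -
    have "?r = real k / (real m' + real n - 1)"
    proof (cases "n * (k - 1) + 1 \<le> m")
      case True
      then have "n * k + 1 \<le> m + n" using \<open>k \<ge> 1\<close> by (cases k) auto
      then have "real (n * k + 1) \<le> real (m + n)" by (simp only: of_nat_le_iff)
      then have "real n * real k \<le> real m + real n - 1" by simp
      then have "real k / (real m + real n - 1) \<le> 1 / real n"
        using assms by (simp add: field_simps)
      then show ?thesis using True by (simp add: m'_def)
    next
      case False
      then have "m + n \<le> n * k + 1" using \<open>k \<ge> 1\<close> by (cases k) auto
      then have "real (m + n) \<le> real (n * k + 1)" by (simp only: of_nat_le_iff)
      then have "real m + real n - 1 \<le> real n * real k" by simp
      then have "1 / real n \<le> real k / (real m + real n - 1)"
        using assms by (simp add: field_simps)
      moreover have "real m' + real n - 1 = real n * real k"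
        using False \<open>k \<ge> 1\<close> by (cases k) (auto simp: m'_def algebra_simps)
      ultimately show ?thesis using assms by simp
    qed
    then have "?r * V i ?C = real k * c i" by (simp add: c_def)
    then show ?thesis using Z(2)[OF i] M(2)[OF i ZC(2)[OF i] ZC(1)[OF i]] by simp
  qed
  ultimately show "\<exists>Z. allocation ?C n Z \<and> feasible Islands k n Z \<and> (\<forall>i\<in>{1..n}. V i (Z i) \<ge> ?r * V i ?C)"
    by blast
qed

section \<open>A multicake that admits no larger ratio\<close>

text \<open>
  All agents agree that each island but the last is worth \<open>1\<close> and the last is worth \<open>n\<close>. An agent who
  gets more than \<open>k\<close> from at most \<open>k\<close> intervals has one in the last island; the at most \<open>k - 1\<close> intervals
  elsewhere contribute at most \<open>1\<close> each, so more than \<open>1\<close> comes from the last island. This is impossible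
  for all \<open>n\<close> agents at once. The bound \<open>1 / n\<close> holds because the agents agree.
\<close>
lemma guaranteed_le_min:
  assumes m: "m \<ge> 1" and k: "k \<ge> 1" and n: "n \<ge> 1" and r: "guaranteed m k n r"
  shows "r \<le> min (1 / real n) (real k / (real m + real n - 1))"
proof -
  define I where "I j = {2 * real j..2 * real j + 1}" for j
  define h where "h j = (if Suc j < m then 1 else real n)" for j
  define v where "v x = (if x < 2 * real (m - 1) then 1 else real n)" for x :: real
  let ?C = "\<Union>j<m. I j"
  have v_on: "v x = h j" if "x \<in> I j" "j < m" for x j
  proof (cases "Suc j < m")
    case True
    then have "real j + 1 \<le> real (m - 1)" by linarith
    then show ?thesis using that True by (auto simp: v_def h_def I_def)
  next
    case False
    then have "j = m - 1" using that by linarith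
    then show ?thesis using that False by (auto simp: v_def h_def I_def)
  qed
  have I_leb: "I j \<in> sets lebesgue" "measure lebesgue (I j) = 1" "emeasure lebesgue (I j) < \<infinity>" for j
    by (auto simp: I_def)
  have v_I: "set_integrable lebesgue (I j) v" "(LINT x:I j|lebesgue. v x) = h j" if "j < m" for j
  proof -
    have "set_integrable lebesgue (I j) (\<lambda>_. h j)"
      unfolding set_integrable_def using I_leb by (intro integrable_scaleR_left) (auto intro: integrable_real_indicator)
    then show "set_integrable lebesgue (I j) v"
      using v_on that by (subst set_integrable_cong[of _ _ "I j" "I j" _ "\<lambda>_. h j"]) auto
    have "(LINT x:I j|lebesgue. v x) = (LINT x:I j|lebesgue. h j)"
      using v_on that I_leb by (intro set_lebesgue_integral_cong) auto
    then show "(LINT x:I j|lebesgue. v x) = h j"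
      using I_leb[of j] by (simp add: set_lebesgue_integral_def)
  qed
  have I_disj: "disjoint_family_on I {..<m}"
    unfolding disjoint_family_on_def
  proof (intro ballI impI)
    fix a b :: nat assume "a \<noteq> b"
    then have "real a + 1 \<le> real b \<or> real b + 1 \<le> real a" by linarith
    then show "I a \<inter> I b = {}" by (auto simp: I_def)
  qed
  have I_ne: "I j \<noteq> {}" for j by (simp add: I_def)
  have I_inj: "inj_on I {..<m}"
    using I_disj I_ne by (intro inj_onI) (metis disjoint_family_onD Int_absorb)
  have "disjoint (I ` {..<m})"
    using I_disj by (intro disjoint_family_on_disjoint_image)
  then have "multicake m (I ` {..<m})"
    using card_image[OF I_inj] by (auto simp: multicake_def I_def is_interval_cc)
  moreover have vm: "value_measure ?C (\<lambda>Z. LINT x:Z|lebesgue. v x)"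
    unfolding value_measure_def
  proof (intro exI[of _ v] conjI)
    show "set_integrable lebesgue ?C v"
      using v_I I_leb by (intro set_integrable_UN) auto
  qed (auto simp: v_def)
  ultimately have "\<exists>Z. allocation ?C n Z \<and> feasible (I ` {..<m}) k n Z \<and>
      (\<forall>i\<in>{1..n}. (LINT x:Z i|lebesgue. v x) \<ge> r * (LINT x:?C|lebesgue. v x))"
    using r[unfolded guaranteed_def, rule_format, of "I ` {..<m}" "\<lambda>_ Z. LINT x:Z|lebesgue. v x"]
    by auto
  then obtain Z where Z: "allocation ?C n Z" "feasible (I ` {..<m}) k n Z"
    "\<And>i. i \<in> {1..n} \<Longrightarrow> (LINT x:Z i|lebesgue. v x) \<ge> r * (LINT x:?C|lebesgue. v x)"
    by blast
  have I_borel: "I j \<in> sets borel" for j by (simp add: I_def)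
  then have C: "?C \<in> sets borel" by auto
  obtain M where M: "atomless_borel_measure M"
    "\<And>Z. Z \<in> sets borel \<Longrightarrow> Z \<subseteq> ?C \<Longrightarrow> (LINT x:Z|lebesgue. v x) = measure M Z"
    using value_measure_as_borel_measure[OF vm C] by metis
  interpret atomless_borel_measure M by (fact M(1))
  have MI: "measure M (I j) = h j" if "j < m" for j
    using M(2)[OF I_borel, of j] v_I(2)[OF that] UN_upper[of j "{..<m}" I] that by simp
  have MC: "measure M ?C = real m + real n - 1"
  proof -
    have "measure M ?C = (\<Sum>j<m. h j)"
      using I_disj I_borel MI by (subst finite_measure_finite_Union) (auto intro: borel_in_sets)
    also have "\<dots> = (\<Sum>j<m - 1. h j) + h (m - 1)"
      using m by (cases m) auto
    also have "(\<Sum>j<m - 1. h j) = (\<Sum>j<m - 1. 1)" by (intro sum.cong) (auto simp: h_def)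
    also have "\<dots> + h (m - 1) = real m + real n - 1" using m by (simp add: h_def of_nat_diff)
    finally show ?thesis .
  qed
  have pos: "real m + real n - 1 > 0" using m n by simp
  have port: "portion k (I ` {..<m}) (Z i)" if "i \<in> {1..n}" for i
    using Z(2) that by (simp add: feasible_iff_portion)
  have Zi: "Z i \<in> sets borel" "Z i \<subseteq> ?C" "r * (real m + real n - 1) \<le> measure M (Z i)" if "i \<in> {1..n}" for i
    using Z(1) Z(3)[OF that] port[OF that] portion_borel that M(2) C MC by (auto simp: allocation_def)
  have Z_disj: "disjoint_family_on Z {1..n}" using Z(1) by (simp add: allocation_def)
  have "r \<le> 1 / real n"
  proof -
    have "real n * (r * (real m + real n - 1)) = (\<Sum>i\<in>{1..n}. r * (real m + real n - 1))" by simp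
    also have "\<dots> \<le> (\<Sum>i\<in>{1..n}. measure M (Z i))" using Zi by (intro sum_mono) auto
    also have "\<dots> = measure M (\<Union>i\<in>{1..n}. Z i)"
      using Z_disj Zi by (intro finite_measure_finite_Union[symmetric]) (auto intro: borel_in_sets)
    also have "\<dots> \<le> real m + real n - 1"
      unfolding MC[symmetric] using Zi(2) C by (intro finite_measure_mono borel_in_sets UN_least)
    finally have "(real n * r) * (real m + real n - 1) \<le> 1 * (real m + real n - 1)" by (simp add: mult.assoc)
    then have "real n * r \<le> 1" using pos by (simp only: mult_le_cancel_right_pos)
    then show ?thesis using n by (simp add: field_simps)
  qed
  moreover have "r \<le> real k / (real m + real n - 1)"
  proof (rule ccontr)
    let ?L = "I (m - 1)"
    assume "\<not> r \<le> real k / (real m + real n - 1)"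
    then have big: "real k < r * (real m + real n - 1)" using pos by (simp add: field_simps)
    have last: "1 < measure M (Z i \<inter> ?L)" if i: "i \<in> {1..n}" for i
    proof -
      obtain \<J> where J: "finite \<J>" "card \<J> \<le> k" "Z i = \<Union>\<J>"
        "\<forall>A\<in>\<J>. is_interval A \<and> (\<exists>D\<in>I ` {..<m}. A \<subseteq> D)"
        using port[OF i] unfolding portion_def by blast
      define B where "B = {A\<in>\<J>. \<not> A \<subseteq> ?L}"
      have B_borel: "A \<in> sets borel" if "A \<in> B" for A
        using J(4) that by (auto simp: B_def intro: real_interval_borel_measurable)
      have B_small: "measure M A \<le> 1" if A: "A \<in> B" for A
      proof -
        obtain j where j: "j < m" "A \<subseteq> I j" using J(4) A by (auto simp: B_def)
        then have "j \<noteq> m - 1" using A by (auto simp: B_def)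
        then have "Suc j < m" using j(1) by linarith
        then have "measure M (I j) = 1" using j MI by (simp add: h_def)
        moreover have "measure M A \<le> measure M (I j)"
          using j I_borel by (intro finite_measure_mono borel_in_sets) auto
        ultimately show ?thesis by simp
      qed
      have finB: "finite B" using J(1) by (simp add: B_def)
      have UB: "\<Union>B \<in> sets borel" using finB B_borel by (intro sets.finite_Union) auto
      have "measure M (\<Union>B) \<le> (\<Sum>A\<in>B. measure M A)"
        using finite_measure_subadditive_finite[of B "\<lambda>A. A"] finB B_borel borel_in_sets by auto
      also have "\<dots> \<le> (\<Sum>A\<in>B. 1)" by (intro sum_mono B_small)
      finally have MB: "measure M (\<Union>B) \<le> card B" by simp
      have "measure M (Z i) \<le> measure M ((Z i \<inter> ?L) \<union> \<Union>B)"
        using UB Zi(1)[OF i] I_borel J(3) by (intro finite_measure_mono sets.Un borel_in_sets) (auto simp: B_def)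
      also have "\<dots> \<le> measure M (Z i \<inter> ?L) + measure M (\<Union>B)"
        using UB Zi(1)[OF i] I_borel by (intro measure_Un_le borel_in_sets) auto
      finally have split: "real k < measure M (Z i \<inter> ?L) + card B" using MB Zi(3)[OF i] big by linarith
      have "card B < k"
      proof (rule ccontr)
        assume "\<not> card B < k"
        then have "B = \<J>" using J(1,2) by (intro card_seteq) (auto simp: B_def)
        then have "measure M (Z i) \<le> k" using MB J(2,3) by simp
        then show False using Zi(3)[OF i] big by linarith
      qed
      then show ?thesis using split by linarith
    qed
    have "real n = (\<Sum>i\<in>{1..n}. 1)" by simp
    also have "\<dots> < (\<Sum>i\<in>{1..n}. measure M (Z i \<inter> ?L))" using last n by (intro sum_strict_mono) auto
    also have "\<dots> = measure M (\<Union>i\<in>{1..n}. Z i \<inter> ?L)"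
      using Z_disj Zi I_borel
      by (intro finite_measure_finite_Union[symmetric])
         (auto intro!: borel_in_sets simp: disjoint_family_on_def)
    also have "\<dots> \<le> measure M ?L"
      using I_borel by (intro finite_measure_mono borel_in_sets) auto
    also have "\<dots> = real n" using MI[of "m - 1"] m by (simp add: h_def)
    finally show False by simp
  qed
  ultimately show ?thesis by simp
qed

theorem theorem1:
  fixes m k n :: nat
  assumes "m \<ge> 1" and "k \<ge> 1" and "n \<ge> 1"
  shows "guaranteed m k n (best_ratio m k n) \<and>
         (\<forall>r. guaranteed m k n r \<longrightarrow> r \<le> best_ratio m k n) \<and>
         best_ratio m k n = min (1 / real n) (real k / (real m + real n - 1))"
proof -
  have "best_ratio m k n = min (1 / real n) (real k / (real m + real n - 1))"
    unfolding best_ratio_def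
    by (intro Greatest_equality guaranteed_min guaranteed_le_min assms)
  then show ?thesis
    using guaranteed_min[OF assms] guaranteed_le_min[OF assms] by simp
qed

end
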